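(* A proper Euler magic matrix of order $9$ exists. Explicitly, let $$A=\begin{pmatrix}28&47&16\\44&-32&17\\23&4&-52\end{pmatrix},\qquad B=\begin{pmatrix}75&54&22\\50&-78&21\\30&-5&-90\end{pmatrix},\qquad L_9=\begin{pmatrix}1&1\\2&1\end{pmatrix}\in GL_2(\mathbb{F}_3).$$ Then the matrix $M_9=M_{L_9}(A,B)$, given by $$M_9=\begin{pmatrix} 2100& 1512& 616& 3525& 2538& 1034& 1200& 864& 352\\ 2200&-3432& 924&-1600& 2496& -672& 850&-1326& 357\\ 690& -115&-2070& 120& -20& -360&-1560& 260& 4680\\ 1320& -220&-3960& -960& 160& 2880& 510& -85&-1530\\ 1725& 1242& 506& 300& 216& 88&-3900&-2808&-1144\\ 1400&-2184& 588& 2350&-3666& 987& 800&-1248& 336\\ 1150&-1794& 483& 200& -312& 84&-2600& 4056&-1092\\ 840& -140&-2520& 1410& -235&-4230& 480& -80&-1440\\ 3300& 2376& 968&-2400&-1728& -704& 1275& 918& 374 \end{pmatrix},$$ is a proper Euler magic matrix with constant $\gamma=3249\cdot9025=29\,322\,225=5415^2$. Its entries have greatest common divisor $1$.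
   Context: A matrix $M\in\mathbb{Z}^{n\times n}$ (indices $0,\dots,n-1$) is an Euler magic matrix of order $n$ with constant $\gamma\in\mathbb{Z}$, $\gamma\ne0$, if $MM^{\mathsf T}=\gamma I$, $\sum_{i=0}^{n-1}M_{i,i}^2=\gamma$ and $\sum_{i=0}^{n-1}M_{i,n-1-i}^2=\gamma$. It is proper if the $n^2$ entry squares $M_{i,j}^2$ are pairwise distinct. The set $\{0,1,\dots,3^k-1\}$ is identified with $\mathbb{F}_3^k$ by base-three digits, most significant first: $v=(v_1,\dots,v_k)$ corresponds to $\sum_{i=1}^k v_i3^{k-i}$ (with $v_i\in\{0,1,2\}$). Rows and columns of $3\times 3$ matrices are indexed by $\mathbb{F}_3=\{0,1,2\}$. For $L\in GL_k(\mathbb{F}_3)$ and $A_1,\dots,A_k\in\mathbb{Z}^{3\times3}$, the $L$-reindexed tensor product $M_L(A_1,\dots,A_k)\in\mathbb{Z}^{3^k\times3^k}$ has entries $M_L(A_1,\dots,A_k)_{v,w}=\prod_{i=1}^k(A_i)_{(Lv)_i,\,w_i}$ for $v,w\in\mathbb{F}_3^k$. Here $k=2$. *)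

theory Defs
  imports "Jordan_Normal_Form.Matrix" "Berlekamp_Zassenhaus.Finite_Field"
begin

section \<open>Euler magic matrices\<close>

definition euler_magic :: "nat \<Rightarrow> int \<Rightarrow> int mat \<Rightarrow> bool" where
  "euler_magic n \<gamma> M \<longleftrightarrow>
     M \<in> carrier_mat n n \<and> \<gamma> \<noteq> 0 \<and>
     M * transpose_mat M = \<gamma> \<cdot>\<^sub>m 1\<^sub>m n \<and>
     (\<Sum>i<n. (M $$ (i, i))\<^sup>2) = \<gamma> \<and>
     (\<Sum>i<n. (M $$ (i, n - 1 - i))\<^sup>2) = \<gamma>"

definition proper_euler_magic :: "nat \<Rightarrow> int \<Rightarrow> int mat \<Rightarrow> bool" where
  "proper_euler_magic n \<gamma> M \<longleftrightarrow>
     euler_magic n \<gamma> M \<and> inj_on (\<lambda>(i, j). (M $$ (i, j))\<^sup>2) ({..<n} \<times> {..<n})"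


section \<open>The field with three elements and base-three digits\<close>

text \<open>The type \<open>Enum.finite_3\<close> only supplies the cardinality 3; the arithmetic is that of
  \<open>mod_ring\<close>, i.e. integers modulo 3 with representatives 0, 1, 2.\<close>

lemma card_finite_3: "CARD(Enum.finite_3) = 3"
  by (simp add: UNIV_finite_3)

instance Enum.finite_3 :: prime_card
  by standard (simp add: card_finite_3)

type_synonym F3 = "Enum.finite_3 mod_ring"

definition F3_index :: "F3 \<Rightarrow> nat" where
  "F3_index a = nat (to_int_mod_ring a)"

text \<open>Vectors are indexed from 0, so component \<open>i\<close> is the digit \<open>v\<^sub>i\<^sub>+\<^sub>1\<close> and has weight
  \<open>3 ^ (k - 1 - i)\<close> (most significant digit first).\<close>

definition base3_value :: "nat \<Rightarrow> F3 vec \<Rightarrow> nat" where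
  "base3_value k v = (\<Sum>i<k. F3_index (v $ i) * 3 ^ (k - 1 - i))"

definition base3_digits :: "nat \<Rightarrow> nat \<Rightarrow> F3 vec" where
  "base3_digits k x = vec k (\<lambda>i. of_nat (x div 3 ^ (k - 1 - i) mod 3))"

lemma F3_index_of_nat: "F3_index (of_nat m) = m mod 3"
proof -
  have "to_int_mod_ring (of_nat m :: F3) = int m mod 3"
    unfolding of_nat_of_int_mod_ring o_def
    by (simp add: to_int_mod_ring.rep_eq of_int_mod_ring.rep_eq card_finite_3)
  then show ?thesis
    by (simp add: F3_index_def nat_mod_distrib)
qed

lemma base3_digits_carrier: "base3_digits k x \<in> carrier_vec k"
  by (simp add: base3_digits_def)

lemma base3_value_digits:
  assumes "x < 3 ^ k"
  shows "base3_value k (base3_digits k x) = x"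
proof -
  have expansion: "(\<Sum>i<k. x div 3 ^ i mod 3 * 3 ^ i) = x mod 3 ^ k" for k
  proof (induction k)
    case (Suc k)
    have "x mod 3 ^ Suc k = 3 ^ k * (x div 3 ^ k mod 3) + x mod 3 ^ k"
      unfolding power_Suc2 by (rule mod_mult2_eq)
    with Suc show ?case
      by (simp add: mult.commute)
  qed simp
  have "base3_value k (base3_digits k x) =
      (\<Sum>i<k. x div 3 ^ (k - Suc i) mod 3 * 3 ^ (k - Suc i))"
    by (simp add: base3_value_def base3_digits_def F3_index_of_nat)
  also have "\<dots> = (\<Sum>i<k. x div 3 ^ i mod 3 * 3 ^ i)"
    by (rule sum.nat_diff_reindex)
  finally show ?thesis
    using assms by (simp add: expansion)
qed


section \<open>Reindexed tensor products\<close>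

definition general_linear :: "nat \<Rightarrow> 'a::semiring_1 mat set" where
  "general_linear k = {L \<in> carrier_mat k k. invertible_mat L}"

text \<open>The number \<open>k\<close> of factors is the length of the list; it is meant to be applied to
  \<open>3 \<times> 3\<close> matrices and \<open>L \<in> general_linear k\<close>.\<close>

definition reindexed_tensor :: "F3 mat \<Rightarrow> int mat list \<Rightarrow> int mat" where
  "reindexed_tensor L As = (let k = length As in
     mat (3 ^ k) (3 ^ k) (\<lambda>(v, w).
       \<Prod>i<k. (As ! i) $$ (F3_index ((L *\<^sub>v base3_digits k v) $ i),
                           F3_index (base3_digits k w $ i))))"


section \<open>The matrices of order 9\<close>

definition A9 :: "int mat" where
  "A9 = mat_of_rows_list 3
    [[28,  47,  16],
     [44, -32,  17],
     [23,   4, -52]]"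

definition B9 :: "int mat" where
  "B9 = mat_of_rows_list 3
    [[75,  54,  22],
     [50, -78,  21],
     [30,  -5, -90]]"

definition L9 :: "F3 mat" where
  "L9 = mat_of_rows_list 2
    [[1, 1],
     [2, 1]]"

definition M9 :: "int mat" where
  "M9 = mat_of_rows_list 9
    [[2100,  1512,   616,  3525,  2538,  1034,  1200,   864,   352],
     [2200, -3432,   924, -1600,  2496,  -672,   850, -1326,   357],
     [ 690,  -115, -2070,   120,   -20,  -360, -1560,   260,  4680],
     [1320,  -220, -3960,  -960,   160,  2880,   510,   -85, -1530],
     [1725,  1242,   506,   300,   216,    88, -3900, -2808, -1144],
     [1400, -2184,   588,  2350, -3666,   987,   800, -1248,   336],
     [1150, -1794,   483,   200,  -312,    84, -2600,  4056, -1092],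
     [ 840,  -140, -2520,  1410,  -235, -4230,   480,   -80, -1440],
     [3300,  2376,   968, -2400, -1728,  -704,  1275,   918,   374]]"

end

theory Submission
  imports Defs
begin

text \<open>The rows of \<open>A9\<close> are orthogonal with square norm 3249, those of
  \<open>B9\<close> with 9025, so the Kronecker product has orthogonal rows of square norm 3249 *
  9025; the invertible \<open>L9\<close> only permutes these rows. This explains \<gamma>, but the
  proof evaluates the explicit matrix instead: \<open>M9_mult_transpose\<close> computes all row
  products, \<open>euler_magic_M9\<close> adds the two diagonal sums, and
  \<open>inj_on_M9_squares\<close> compares the 81 squares. \<open>reindexed_tensor_L9\<close> ties
  the table to the construction by turning arithmetic in \<open>F3\<close> into remainders of
  naturals.\<close>

lemma upt_9: "[0..<9] = [0, 1, 2, 3, 4, 5, 6, 7, 8::nat]"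
  by (simp add: upt_rec)

text \<open>Replaces bounded indices by numerals, so that claims about all entries become ground
  integer arithmetic.\<close>

lemma all_less_9_iff:
  "(\<forall>i<9. P i) \<longleftrightarrow> P 0 \<and> P 1 \<and> P 2 \<and> P 3 \<and> P 4 \<and> P 5 \<and> P 6 \<and> P 7 \<and> P (8::nat)"
  by (simp add: numeral_eq_Suc All_less_Suc conj_commute conj_left_commute)

lemma sum_lessThan_9:
  "(\<Sum>i<9. f i) = f 0 + f 1 + f 2 + f 3 + f 4 + f 5 + f 6 + f 7 + f (8::nat)"
  by (simp add: numeral_eq_Suc)

lemma mat_of_rows_list_carrier:
  "length rs = n \<Longrightarrow> mat_of_rows_list nc rs \<in> carrier_mat n nc"
  by (simp add: mat_of_rows_list_def)

lemma mat_of_rows_list_index: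
  "i < length rs \<Longrightarrow> j < nc \<Longrightarrow> mat_of_rows_list nc rs $$ (i, j) = rs ! i ! j"
  by (simp add: mat_of_rows_list_def)

lemma M9_carrier: "M9 \<in> carrier_mat 9 9"
  unfolding M9_def by (rule mat_of_rows_list_carrier) simp

lemma M9_index_rows:
  "\<forall>i<9. \<forall>j<9. M9 $$ (i, j) =
    [[2100,  1512,   616,  3525,  2538,  1034,  1200,   864,   352],
     [2200, -3432,   924, -1600,  2496,  -672,   850, -1326,   357],
     [ 690,  -115, -2070,   120,   -20,  -360, -1560,   260,  4680],
     [1320,  -220, -3960,  -960,   160,  2880,   510,   -85, -1530],
     [1725,  1242,   506,   300,   216,    88, -3900, -2808, -1144],
     [1400, -2184,   588,  2350, -3666,   987,   800, -1248,   336],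
     [1150, -1794,   483,   200,  -312,    84, -2600,  4056, -1092],
     [ 840,  -140, -2520,  1410,  -235, -4230,   480,   -80, -1440],
     [3300,  2376,   968, -2400, -1728,  -704,  1275,   918,   374]] ! i ! j"
  unfolding M9_def by (intro allI impI mat_of_rows_list_index) simp_all

text \<open>Later computations rewrite with the 81 entries; unfolding \<open>M9\<close> itself makes the
  simplifier traverse the whole list of rows at every access.\<close>
lemmas M9_index = M9_index_rows[unfolded all_less_9_iff, simplified]

lemma M9_mult_transpose: "M9 * transpose_mat M9 = 29322225 \<cdot>\<^sub>m 1\<^sub>m 9"
proof -
  have dim: "dim_row M9 = 9" "dim_col M9 = 9"
    using M9_carrier by auto
  have entries: "\<forall>i<9. \<forall>j<9. (\<Sum>k<9. M9 $$ (i, k) * M9 $$ (j, k)) =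
      (if i = j then 29322225 else 0)"
    unfolding all_less_9_iff sum_lessThan_9
    by (simp add: M9_index)
  show ?thesis
  proof (rule eq_matI)
    fix i j
    assume "i < dim_row (29322225 \<cdot>\<^sub>m 1\<^sub>m 9 :: int mat)" "j < dim_col (29322225 \<cdot>\<^sub>m 1\<^sub>m 9 :: int mat)"
    then have ij: "i < 9" "j < 9"
      by simp_all
    then have "(M9 * transpose_mat M9) $$ (i, j) = (\<Sum>k<9. M9 $$ (i, k) * M9 $$ (j, k))"
      by (simp add: dim scalar_prod_def lessThan_atLeast0)
    with entries ij show "(M9 * transpose_mat M9) $$ (i, j) = (29322225 \<cdot>\<^sub>m 1\<^sub>m 9) $$ (i, j)"
      by simp
  qed (simp_all add: dim)
qed

lemma euler_magic_M9: "euler_magic 9 29322225 M9"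
  unfolding euler_magic_def sum_lessThan_9
  using M9_carrier M9_mult_transpose
  by (simp add: M9_index)

lemma inj_on_M9_squares: "inj_on (\<lambda>(i, j). (M9 $$ (i, j))\<^sup>2) ({..<9} \<times> {..<9})"
proof -
  \<comment> \<open>Injectivity on the finite grid is decided as distinctness of a list of 81
    numerals.\<close>
  have "distinct (map (\<lambda>(i, j). (M9 $$ (i, j))\<^sup>2) (List.product [0..<9] [0..<9]))"
    unfolding upt_9 by (simp add: M9_index)
  then show ?thesis
    by (simp add: distinct_map lessThan_atLeast0)
qed

lemma L9_carrier: "L9 \<in> carrier_mat 2 2"
  unfolding L9_def by (rule mat_of_rows_list_carrier) simp

lemma L9_in_general_linear: "L9 \<in> general_linear 2"
proof -
  \<comment> \<open>The determinant 1 - 2 = -1 is already a unit over the integers, so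
    \<open>K\<close> is the negated adjugate and no reduction modulo 3 is needed.\<close>
  define K :: "F3 mat" where "K = mat_of_rows_list 2 [[-1, 1], [2, -1]]"
  have carrier: "L9 \<in> carrier_mat 2 2" "K \<in> carrier_mat 2 2"
    unfolding L9_def K_def by (rule mat_of_rows_list_carrier, simp)+
  moreover have "L9 * K = 1\<^sub>m 2" "K * L9 = 1\<^sub>m 2"
    using carrier
    by (auto simp: mat_eq_iff less_Suc_eq scalar_prod_def numeral_2_eq_2
        L9_def K_def mat_of_rows_list_index)
  ultimately show ?thesis
    unfolding general_linear_def invertible_mat_def inverts_mat_def by auto
qed

text \<open>The digits of \<open>v\<close> are \<open>v div 3\<close> and \<open>v mod 3\<close>
  modulo 3, and the last digit may be replaced by \<open>v\<close> itself under the outer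
  \<open>mod 3\<close>.\<close>

lemma F3_index_L9_mult:
  "F3_index ((L9 *\<^sub>v base3_digits 2 v) $ 0) = (v div 3 + v) mod 3"
  "F3_index ((L9 *\<^sub>v base3_digits 2 v) $ 1) = (2 * (v div 3) + v) mod 3"
proof -
  have "(L9 *\<^sub>v base3_digits 2 v) $ 0 = of_nat (v div 3 mod 3 + v mod 3)"
    "(L9 *\<^sub>v base3_digits 2 v) $ 1 = of_nat (2 * (v div 3 mod 3) + v mod 3)"
    using L9_carrier
    by (auto simp: base3_digits_def scalar_prod_def numeral_2_eq_2
        L9_def mat_of_rows_list_index)
  \<comment> \<open>The inner \<open>mod 3\<close> sits below the factor 2, where
    \<open>mod_add_eq\<close> does not reach it.\<close>
  moreover have "(2 * (v div 3 mod 3) + v mod 3) mod 3 = (2 * (v div 3) + v) mod 3"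
    by (rule mod_add_cong[OF mod_mult_right_eq mod_mod_trivial])
  ultimately show
    "F3_index ((L9 *\<^sub>v base3_digits 2 v) $ 0) = (v div 3 + v) mod 3"
    "F3_index ((L9 *\<^sub>v base3_digits 2 v) $ 1) = (2 * (v div 3) + v) mod 3"
    by (simp_all only: F3_index_of_nat mod_add_eq)
qed

lemma reindexed_tensor_L9: "reindexed_tensor L9 [A9, B9] = M9"
proof (rule eq_matI)
  \<comment> \<open>The two factors of the tensor entry, with \<open>F3\<close> eliminated by
    \<open>F3_index_L9_mult\<close> and \<open>F3_index_of_nat\<close>: 81 integer products to
    check.\<close>
  have entries: "\<forall>v<9. \<forall>w<9.
      A9 $$ ((v div 3 + v) mod 3, w div 3 mod 3) * B9 $$ ((2 * (v div 3) + v) mod 3, w mod 3) =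
      M9 $$ (v, w)"
    unfolding all_less_9_iff
    by (simp add: M9_index A9_def B9_def mat_of_rows_list_index)
  fix v w
  assume "v < dim_row M9" "w < dim_col M9"
  then have "v < 9" "w < 9"
    using M9_carrier by auto
  with entries show "reindexed_tensor L9 [A9, B9] $$ (v, w) = M9 $$ (v, w)"
    using F3_index_L9_mult[of v]
    by (simp add: reindexed_tensor_def base3_digits_def F3_index_of_nat numeral_2_eq_2)
qed (use M9_carrier in \<open>auto simp: reindexed_tensor_def\<close>)

lemma Gcd_elements_M9: "Gcd (elements_mat M9) = 1"
proof -
  \<comment> \<open>These entries are -85 and 84; their sum -1 is divisible by the gcd.\<close>
  have "M9 $$ (3, 7) \<in> elements_mat M9" "M9 $$ (6, 5) \<in> elements_mat M9"
    using M9_carrier by (auto intro!: elements_matI)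
  then have "Gcd (elements_mat M9) dvd M9 $$ (3, 7) + M9 $$ (6, 5)"
    by (intro dvd_add Gcd_dvd)
  then show ?thesis
    by (simp add: M9_index)
qed

theorem theorem4p1:
  shows "(\<exists>\<gamma> M. proper_euler_magic 9 \<gamma> M) \<and>
    L9 \<in> general_linear 2 \<and>
    reindexed_tensor L9 [A9, B9] = M9 \<and>
    proper_euler_magic 9 29322225 M9 \<and>
    (29322225::int) = 3249 * 9025 \<and>
    (29322225::int) = 5415\<^sup>2 \<and>
    Gcd (elements_mat M9) = 1"
proof -
  have "proper_euler_magic 9 29322225 M9"
    unfolding proper_euler_magic_def using euler_magic_M9 inj_on_M9_squares by simp
  then show ?thesis
    using L9_in_general_linear reindexed_tensor_L9 Gcd_elements_M9 by auto
qed

end
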